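(* Let $\mathcal{G}=(\mathcal{V},\mathcal{E},\mathcal{A})$ be a directed graph on $N$ nodes with adjacency matrix $\mathcal{A}=[a_{ij}]\in\mathbb{R}^{N\times N}$ and Laplacian $L$. Let $\rho>0$ and let $\bar{x}_1,\dots,\bar{x}_N\in\mathbb{R}$ be arbitrary fixed constants. Consider $N$ agents with positions $x_i:[0,\infty)\to\mathbb{R}$, and for $i=1,\dots,N$ and $t\ge 0$ define $$z_i(t):=x_i(t)-\bar{x}_i+\rho\int_0^t \sum_{j\in\mathcal{N}_i}a_{ij}\bigl(x_i(s)-x_j(s)\bigr)\,ds .$$ Suppose that (i) the graph $\mathcal{G}$ is strongly connected; (ii) $x_i$ is continuous for all $i=1,\dots,N$; (iii) $z_i$ is bounded on $[0,\infty)$ and $\lim_{t\to\infty}z_i(t)=0$ for all $i=1,\dots,N$. Then for all $i,j\in\{1,\dots,N\}$, $$\lim_{t\to\infty}\bigl(x_i(t)-x_j(t)\bigr)=0 \quad\text{and}\quad \lim_{t\to\infty}x_i(t)=\sum_{k=1}^N\omega_k\bar{x}_k,$$ where $\omega=[\omega_1,\dots,\omega_N]^T\in\mathbb{R}^N$ is the left eigenvector of $L$ associated with the zero eigenvalue, normalized so that $\sum_{k=1}^N\omega_k=1$.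
   Context: A directed graph $\mathcal{G}=(\mathcal{V},\mathcal{E},\mathcal{A})$ has node set $\mathcal{V}=\{1,\dots,N\}$, edge set $\mathcal{E}\subseteq\mathcal{V}\times\mathcal{V}$, and adjacency matrix $\mathcal{A}=[a_{ij}]\in\mathbb{R}^{N\times N}$ with $a_{ij}>0$ if $(j,i)\in\mathcal{E}$ and $a_{ij}=0$ otherwise. The neighbor set of agent $i$ is $\mathcal{N}_i=\{j\in\mathcal{V}:(j,i)\in\mathcal{E}\}$. The in-degree of $i$ is $d_i=\sum_{j=1}^N a_{ij}$, and the Laplacian is $L=\mathrm{diag}\{d_1,\dots,d_N\}-\mathcal{A}$. The graph is strongly connected if there is a directed path between any two distinct nodes (in each direction). For a strongly connected graph, $0$ is a simple eigenvalue of $L$ with right eigenvector $[1,\dots,1]^T$ and with a unique left eigenvector $\omega$ ($\omega^TL=0$) satisfying $\sum_{i=1}^N\omega_i=1$; its entries $\omega_i$ are positive real numbers. *)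

theory Defs
  imports "HOL-Analysis.Analysis" "Graph_Theory.Graph_Theory"
begin

text \<open>
  The nodes are the elements of a finite type, with \<open>CARD('n) = N\<close>. An arc \<open>(j, i)\<close> points from
  \<open>j\<close> to \<open>i\<close>, and \<open>A $ i $ j\<close> is the weight of \<open>(j, i)\<close>. Self-loops are allowed; they cancel in
  the Laplacian.
\<close>

definition adjacency_matrix :: "'n::finite pair_pre_digraph \<Rightarrow> real^'n^'n \<Rightarrow> bool" where
  "adjacency_matrix G A \<longleftrightarrow>
     pverts G = UNIV \<and>
     (\<forall>i j. if (j, i) \<in> parcs G then A $ i $ j > 0 else A $ i $ j = 0)"

definition in_neighbors :: "'n pair_pre_digraph \<Rightarrow> 'n \<Rightarrow> 'n set" where
  "in_neighbors G i = {j \<in> pverts G. (j, i) \<in> parcs G}"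

definition weighted_in_degree :: "real^'n^'n \<Rightarrow> 'n::finite \<Rightarrow> real" where
  "weighted_in_degree A i = (\<Sum>j\<in>UNIV. A $ i $ j)"

definition diag :: "('n \<Rightarrow> real) \<Rightarrow> real^'n^'n::finite" where
  "diag d = (\<chi> i j. if i = j then d i else 0)"

definition laplacian :: "real^'n^'n \<Rightarrow> real^'n^'n::finite" where
  "laplacian A = diag (weighted_in_degree A) - A"

definition left_eigenvector :: "real^'n^'n \<Rightarrow> real \<Rightarrow> real^'n::finite \<Rightarrow> bool" where
  "left_eigenvector M c w \<longleftrightarrow> w \<noteq> 0 \<and> w v* M = c *\<^sub>R w"

definition normalized_left_null :: "real^'n^'n \<Rightarrow> real^'n::finite" where
  "normalized_left_null M =
     (THE w. left_eigenvector M 0 w \<and> (\<Sum>k\<in>UNIV. w $ k) = 1)"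

text \<open>The description is proper for the Laplacian of a strongly connected graph.\<close>

lemma left_null_laplacian_iff:
  "w v* laplacian A = 0 \<longleftrightarrow>
     (\<forall>j. w $ j * weighted_in_degree A j = (\<Sum>i\<in>UNIV. w $ i * A $ i $ j))"
proof -
  have "(w v* laplacian A) $ j =
      w $ j * weighted_in_degree A j - (\<Sum>i\<in>UNIV. w $ i * A $ i $ j)" for j
  proof -
    have "(w v* laplacian A) $ j = (\<Sum>i\<in>UNIV.
        (if i = j then w $ j * weighted_in_degree A j else 0) - w $ i * A $ i $ j)"
      unfolding vector_matrix_mult_def laplacian_def diag_def
      by (auto simp: algebra_simps intro!: sum.cong)
    then show ?thesis by (simp add: sum_subtractf)
  qed
  then show ?thesis by (simp add: vec_eq_iff)
qed

lemma nonneg_left_null: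
  fixes G :: "'n::finite pair_pre_digraph"
  assumes adj: "adjacency_matrix G A" and conn: "strongly_connected (with_proj G)"
    and nn: "\<And>i. u $ i \<ge> 0" and null: "u v* laplacian A = 0"
  shows "u = 0 \<or> (\<forall>i. u $ i > 0)"
proof (rule disjCI)
  assume "\<not> (\<forall>i. u $ i > 0)"
  then obtain j where j: "u $ j = 0" using nn by (meson linorder_not_le order_antisym)
  have A0: "A $ i $ j \<ge> 0" for i j
    using adj unfolding adjacency_matrix_def by (metis order.refl less_imp_le)
  have step: "u $ i = 0" if "u $ k = 0" "(k, i) \<in> parcs G" for k i
  proof -
    have "(\<Sum>i\<in>UNIV. u $ i * A $ i $ k) = 0"
      using null that(1) by (metis left_null_laplacian_iff mult_zero_left)
    then have "u $ i * A $ i $ k = 0"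
      by (subst (asm) sum_nonneg_eq_0_iff) (auto simp: nn A0)
    moreover have "A $ i $ k > 0" using adj that(2) unfolding adjacency_matrix_def by metis
    ultimately show ?thesis by simp
  qed
  have "u $ i = 0" for i
  proof -
    have "(j, i) \<in> rtrancl_on UNIV (parcs G)"
      using conn adj by (auto simp: strongly_connected_def reachable_def adjacency_matrix_def
          with_proj_def arcs_ends_def arc_to_ends_def)
    then show ?thesis by (induction rule: rtrancl_on_induct) (auto simp: j intro: step)
  qed
  then show "u = 0" by (simp add: vec_eq_iff)
qed

lemma left_null_pos_part:
  fixes G :: "'n::finite pair_pre_digraph"
  assumes adj: "adjacency_matrix G A" and null: "w v* laplacian A = 0"
  shows "(\<chi> i. max (w $ i) 0) v* laplacian A = 0"
proof -
  let ?d = "weighted_in_degree A"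
  define u where "u = (\<chi> i. max (w $ i) 0)"
  have A0: "A $ i $ j \<ge> 0" for i j
    using adj unfolding adjacency_matrix_def by (metis order.refl less_imp_le)
  have le: "u $ j * ?d j \<le> (\<Sum>i\<in>UNIV. u $ i * A $ i $ j)" for j
  proof (cases "w $ j > 0")
    case True
    then have "u $ j * ?d j = (\<Sum>i\<in>UNIV. w $ i * A $ i $ j)"
      using null by (simp add: left_null_laplacian_iff u_def)
    also have "\<dots> \<le> (\<Sum>i\<in>UNIV. u $ i * A $ i $ j)"
      by (intro sum_mono mult_right_mono) (auto simp: u_def A0)
    finally show ?thesis .
  next
    case False
    then have "u $ j = 0" by (simp add: u_def)
    moreover have "0 \<le> (\<Sum>i\<in>UNIV. u $ i * A $ i $ j)"
      by (intro sum_nonneg mult_nonneg_nonneg) (auto simp: u_def A0)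
    ultimately show ?thesis by simp
  qed
  have "(\<Sum>j\<in>UNIV. \<Sum>i\<in>UNIV. u $ i * A $ i $ j) = (\<Sum>j\<in>UNIV. u $ j * ?d j)"
    by (subst sum.swap) (simp add: weighted_in_degree_def sum_distrib_left)
  then have "(\<Sum>j\<in>UNIV. (\<Sum>i\<in>UNIV. u $ i * A $ i $ j) - u $ j * ?d j) = 0"
    by (simp add: sum_subtractf)
  then have "\<forall>j\<in>UNIV. (\<Sum>i\<in>UNIV. u $ i * A $ i $ j) - u $ j * ?d j = 0"
    by (subst (asm) sum_nonneg_eq_0_iff) (auto simp: le)
  then show ?thesis by (simp add: left_null_laplacian_iff u_def)
qed

lemma left_null_sign:
  fixes G :: "'n::finite pair_pre_digraph"
  assumes adj: "adjacency_matrix G A" and conn: "strongly_connected (with_proj G)"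
    and null: "w v* laplacian A = 0"
  shows "w = 0 \<or> (\<forall>i. w $ i > 0) \<or> (\<forall>i. w $ i < 0)"
proof -
  have null': "(- w) v* laplacian A = 0"
    using null by (simp add: left_null_laplacian_iff sum_negf)
  have "(\<chi> i. max (w $ i) 0) = 0 \<or> (\<forall>i. (\<chi> i. max (w $ i) 0) $ i > 0)"
    by (rule nonneg_left_null[OF adj conn]) (auto intro!: left_null_pos_part[OF adj] null)
  moreover have "(\<chi> i. max ((- w) $ i) 0) = 0 \<or> (\<forall>i. (\<chi> i. max ((- w) $ i) 0) $ i > 0)"
    by (rule nonneg_left_null[OF adj conn]) (auto intro!: left_null_pos_part[OF adj] null' simp del: vector_uminus_component)
  ultimately show ?thesis
    by (auto simp: vec_eq_iff max_def split: if_splits) (smt (verit))+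
qed

lemma laplacian_left_null_ex1:
  fixes G :: "'n::finite pair_pre_digraph"
  assumes adj: "adjacency_matrix G A" and conn: "strongly_connected (with_proj G)"
  shows "\<exists>!w. left_eigenvector (laplacian A) 0 w \<and> (\<Sum>k\<in>UNIV. w $ k) = 1"
proof -
  have sum0: "w = 0" if "w v* laplacian A = 0" "(\<Sum>k\<in>UNIV. w $ k) = 0" for w
  proof -
    have "(\<Sum>k\<in>UNIV. w $ k) > 0" if "\<forall>i. w $ i > 0" using that by (intro sum_pos) auto
    moreover have "(\<Sum>k\<in>UNIV. - w $ k) > 0" if "\<forall>i. w $ i < 0"
      using that by (intro sum_pos) auto
    ultimately show ?thesis
      using left_null_sign[OF adj conn that(1)] that(2) by (auto simp: sum_negf)
  qed
  have "(laplacian A *v 1) $ i = 0" for i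
  proof -
    have "(laplacian A *v 1) $ i =
        (\<Sum>j\<in>UNIV. (if i = j then weighted_in_degree A i else 0) - A $ i $ j)"
      by (simp add: matrix_vector_mult_def laplacian_def diag_def)
    then show ?thesis by (simp add: sum_subtractf weighted_in_degree_def)
  qed
  then have "laplacian A *v 1 = 0" by (simp add: vec_eq_iff)
  then have "\<not> invertible (laplacian A)"
    by (metis matrix_left_invertible_ker invertible_left_inverse zero_neq_one)
  then have "\<not> invertible (transpose (laplacian A))"
    by (simp add: invertible_det_nz)
  then obtain w where w: "transpose (laplacian A) *v w = 0" "w \<noteq> 0"
    by (metis matrix_left_invertible_ker invertible_left_inverse)
  then have null: "w v* laplacian A = 0" by simp
  define s where "s = (\<Sum>k\<in>UNIV. w $ k)"
  have s: "s \<noteq> 0" using sum0[OF null] w(2) by (auto simp: s_def)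
  show ?thesis
  proof (rule ex1I)
    have "(\<Sum>k\<in>UNIV. (inverse s *\<^sub>R w) $ k) = inverse s * s"
      by (simp add: s_def sum_distrib_left)
    moreover have "(inverse s *\<^sub>R w) v* laplacian A = 0"
      using null by (simp add: left_null_laplacian_iff sum_distrib_left mult.assoc
          flip: sum_distrib_left)
    ultimately show "left_eigenvector (laplacian A) 0 (inverse s *\<^sub>R w) \<and>
        (\<Sum>k\<in>UNIV. (inverse s *\<^sub>R w) $ k) = 1"
      using s w(2) by (simp add: left_eigenvector_def)
  next
    fix v assume v: "left_eigenvector (laplacian A) 0 v \<and> (\<Sum>k\<in>UNIV. v $ k) = 1"
    have "(v - inverse s *\<^sub>R w) v* laplacian A = 0"
      using null v by (simp add: left_null_laplacian_iff left_eigenvector_def left_diff_distrib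
          sum_subtractf sum_distrib_left mult.assoc flip: sum_distrib_left)
    moreover have "(\<Sum>k\<in>UNIV. (v - inverse s *\<^sub>R w) $ k) = 0"
      using v s by (simp add: sum_subtractf s_def flip: sum_distrib_left)
    ultimately show "v = inverse s *\<^sub>R w" using sum0 by fastforce
  qed
qed

end

theory Submission
  imports Defs "HOL-Real_Asymp.Real_Asymp"
begin

text \<open>
  Put \<open>v = x - z\<close>. Then \<open>v' = - \<rho> L v - \<rho> L z\<close>, a consensus flow driven by a vanishing input, and
  \<open>\<omega> \<bullet> v\<close> keeps the constant value \<open>c = \<omega> \<bullet> xbar\<close>. For \<open>e = v - c 1\<close> the Lyapunov function
  \<open>V = \<Sum> \<omega>\<^sub>i e\<^sub>i\<^sup>2\<close> dissipates at the rate \<open>\<rho> \<Sum> \<omega>\<^sub>i a\<^sub>i\<^sub>j (e\<^sub>i - e\<^sub>j)\<^sup>2\<close>. By strong connectivity and compactness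
  this dominates a multiple of \<open>V\<close> on the hyperplane \<open>\<omega> \<bullet> e = 0\<close>, so \<open>V' \<le> - k V + o(1)\<close>
  and \<open>V\<close> tends to 0.
\<close>

text \<open>Gronwall with a vanishing input: as soon as \<open>g\<close> stays below
  \<open>k * \<eta>\<close>, the integrating factor makes
  \<open>exp (k * t) * (V t - \<eta>)\<close> nonincreasing. Hence \<open>V\<close> exceeds
  \<open>\<eta>\<close> by at most an exponentially decaying term.\<close>

lemma tendsto_0_of_deriv_le:
  fixes V V' g :: "real \<Rightarrow> real"
  assumes k: "k > 0" and nn: "\<And>t. V t \<ge> 0"
    and deriv: "\<And>t. t > 0 \<Longrightarrow> (V has_real_derivative V' t) (at t)"
    and le: "\<And>t. t > 0 \<Longrightarrow> V' t \<le> - k * V t + g t"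
    and g: "(g \<longlongrightarrow> 0) at_top"
  shows "(V \<longlongrightarrow> 0) at_top"
proof (rule order_tendstoI)
  fix a :: real assume "a < 0"
  then show "eventually (\<lambda>t. a < V t) at_top" using nn by (intro always_eventually allI) (rule less_le_trans)
next
  fix a :: real assume a: "a > 0"
  define \<eta> where "\<eta> = a / 2"
  have \<eta>: "\<eta> > 0" "\<eta> < a" using a by (auto simp: \<eta>_def)
  have "eventually (\<lambda>t. g t < k * \<eta>) at_top"
    using g k \<eta> by (intro order_tendstoD) auto
  then obtain T0 where T0: "\<And>t. t \<ge> T0 \<Longrightarrow> g t < k * \<eta>"
    by (auto simp: eventually_at_top_linorder)
  \<comment> \<open>The maximum with 1 keeps \<open>[T, t]\<close> inside the open half-line where
    the derivative of \<open>V\<close> is assumed.\<close>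
  define T where "T = max T0 1"
  have bound: "V t \<le> \<eta> + exp (- (k * (t - T))) * V T" if t: "t \<ge> T" for t
  proof -
    have "exp (k * t) * (V t - \<eta>) \<le> exp (k * T) * (V T - \<eta>)"
    proof (rule DERIV_nonpos_imp_nonincreasing[OF t])
      fix s assume s: "T \<le> s" "s \<le> t"
      then have "s > 0" "g s < k * \<eta>" using T0 by (auto simp: T_def)
      then have "V' s + k * (V s - \<eta>) \<le> 0" using le[of s] by (simp add: algebra_simps)
      moreover have "((\<lambda>s. exp (k * s) * (V s - \<eta>)) has_real_derivative
          exp (k * s) * (V' s + k * (V s - \<eta>))) (at s)"
        by (rule derivative_eq_intros deriv refl \<open>s > 0\<close>)+ (simp add: algebra_simps)
      ultimately show "\<exists>y. ((\<lambda>s. exp (k * s) * (V s - \<eta>)) has_real_derivative y) (at s) \<and> y \<le> 0"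
        by (meson exp_ge_zero mult_nonneg_nonpos)
    qed
    also have "\<dots> \<le> exp (k * T) * V T" using \<eta> by simp
    finally have "V t - \<eta> \<le> exp (k * T) * V T / exp (k * t)"
      by (simp add: field_simps)
    also have "\<dots> = exp (- (k * (t - T))) * V T"
      by (simp add: exp_diff exp_minus right_diff_distrib field_simps)
    finally show ?thesis by simp
  qed
  have "((\<lambda>t. \<eta> + exp (- (k * (t - T))) * V T) \<longlongrightarrow> \<eta>) at_top"
    using k by real_asymp
  then have "eventually (\<lambda>t. \<eta> + exp (- (k * (t - T))) * V T < a) at_top"
    using \<eta>(2) by (rule order_tendstoD)
  then show "eventually (\<lambda>t. V t < a) at_top"
    using eventually_ge_at_top[of T] by eventually_elim (use bound in force)
qed

lemma laplacian_mult_component: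
  "(laplacian A *v u) $ i = (\<Sum>j\<in>UNIV. A $ i $ j * (u $ i - u $ j))"
proof -
  have "(laplacian A *v u) $ i =
      (\<Sum>j\<in>UNIV. (if i = j then weighted_in_degree A i * u $ i else 0) - A $ i $ j * u $ j)"
    unfolding matrix_vector_mult_def laplacian_def diag_def
    by (auto simp: algebra_simps intro!: sum.cong)
  then show ?thesis
    by (simp add: sum_subtractf weighted_in_degree_def sum_distrib_right right_diff_distrib)
qed

lemma sum_in_neighbors_laplacian:
  assumes "adjacency_matrix G A"
  shows "(\<Sum>j\<in>in_neighbors G i. A $ i $ j * (u $ i - u $ j)) = (laplacian A *v u) $ i"
  unfolding laplacian_mult_component
proof (rule sum.mono_neutral_left)
  show "\<forall>j\<in>UNIV - in_neighbors G i. A $ i $ j * (u $ i - u $ j) = 0"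
    using assms unfolding adjacency_matrix_def in_neighbors_def
    by (metis (mono_tags, lifting) DiffD2 UNIV_I mem_Collect_eq mult_zero_left)
qed auto

text \<open>The source of the conservation law: pairing with a left null vector kills every drift
  term of the form \<open>L *v u\<close>.\<close>

lemma inner_laplacian_left_null:
  assumes "w v* laplacian A = 0"
  shows "w \<bullet> (laplacian A *v u) = 0"
  using assms by (metis dot_lmul_matrix inner_zero_left)

text \<open>A Dirichlet form. For a left null vector \<open>w\<close> and W = diag(w) it is the
  quadratic form of the symmetrised matrix W L + L^T W.\<close>

definition dissipation :: "real^'n \<Rightarrow> real^'n^'n \<Rightarrow> real^'n::finite \<Rightarrow> real" where
  "dissipation w A e = (\<Sum>i\<in>UNIV. \<Sum>j\<in>UNIV. w $ i * A $ i $ j * (e $ i - e $ j)\<^sup>2)"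

text \<open>Pairing \<open>w\<close> with the Laplacian of the squared entries gives 0, so the sum
  with \<open>(e $ i)\<^sup>2 - (e $ j)\<^sup>2\<close> in place of the squared difference may be
  added freely. The two brackets then combine to \<open>2 * e $ i * (e $ i - e $ j)\<close>. The
  null vector thus does the work of a symmetric \<open>A\<close>.\<close>

lemma dissipation_eq:
  assumes "w v* laplacian A = 0"
  shows "dissipation w A e = 2 * (\<Sum>i\<in>UNIV. w $ i * e $ i * (laplacian A *v e) $ i)"
proof -
  have "0 = w \<bullet> (laplacian A *v (\<chi> i. (e $ i)\<^sup>2))"
    using inner_laplacian_left_null[OF assms] by simp
  also have "\<dots> = (\<Sum>i\<in>UNIV. \<Sum>j\<in>UNIV. w $ i * A $ i $ j * ((e $ i)\<^sup>2 - (e $ j)\<^sup>2))"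
    by (simp add: inner_vec_def laplacian_mult_component sum_distrib_left mult.assoc)
  finally have "dissipation w A e = dissipation w A e +
      (\<Sum>i\<in>UNIV. \<Sum>j\<in>UNIV. w $ i * A $ i $ j * ((e $ i)\<^sup>2 - (e $ j)\<^sup>2))" by simp
  also have "\<dots> = 2 * (\<Sum>i\<in>UNIV. w $ i * e $ i * (laplacian A *v e) $ i)"
    unfolding dissipation_def laplacian_mult_component sum_distrib_left sum.distrib[symmetric]
    by (intro sum.cong refl) (simp add: algebra_simps power2_eq_square)
  finally show ?thesis .
qed

lemma dissipation_scaleR: "dissipation w A (r *\<^sub>R e) = r\<^sup>2 * dissipation w A e"
  by (auto simp: dissipation_def sum_distrib_left power2_eq_square algebra_simps intro!: sum.cong)

lemma adjacency_matrix_nonneg: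
  assumes "adjacency_matrix G A"
  shows "A $ i $ j \<ge> 0"
  using assms unfolding adjacency_matrix_def by (metis order.refl less_imp_le)

lemma dissipation_nonneg:
  assumes "adjacency_matrix G A" and "\<And>i. w $ i > 0"
  shows "dissipation w A e \<ge> 0"
  unfolding dissipation_def
  by (intro sum_nonneg mult_nonneg_nonneg adjacency_matrix_nonneg[OF assms(1)])
    (auto simp: assms(2) less_imp_le)

text \<open>All summands are nonnegative, so each vanishes. The endpoints of every arc then agree,
  and equality spreads along a directed path.\<close>

lemma dissipation_eq_0D:
  fixes G :: "'n::finite pair_pre_digraph"
  assumes adj: "adjacency_matrix G A" and conn: "strongly_connected (with_proj G)"
    and w: "\<And>i. w $ i > 0" and 0: "dissipation w A e = 0"
  shows "e $ i = e $ j"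
proof -
  have nn: "0 \<le> w $ i * A $ i $ j * (e $ i - e $ j)\<^sup>2" for i j
    using adjacency_matrix_nonneg[OF adj] w by (simp add: less_imp_le)
  have "w $ i * A $ i $ j * (e $ i - e $ j)\<^sup>2 = 0" for i j
    using 0 unfolding dissipation_def
    by (simp add: sum_nonneg_eq_0_iff sum_nonneg nn) blast
  then have step: "e $ i = e $ j" if "(j, i) \<in> parcs G" for i j
    using adj that w unfolding adjacency_matrix_def
    by (metis less_irrefl mult_eq_0_iff power_eq_0_iff right_minus_eq)
  have "(j, i) \<in> rtrancl_on UNIV (parcs G)"
    using conn adj by (auto simp: strongly_connected_def reachable_def adjacency_matrix_def
        with_proj_def arcs_ends_def arc_to_ends_def)
  then show ?thesis by (induction rule: rtrancl_on_induct) (auto dest: step)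
qed

text \<open>A spectral gap: zero dissipation forces a constant vector, and positive weights leave
  only 0 among the constants on the hyperplane. The minimum over its unit sphere is therefore
  positive, and quadratic homogeneity extends the bound.\<close>

lemma dissipation_gap:
  fixes G :: "'n::finite pair_pre_digraph"
  assumes adj: "adjacency_matrix G A" and conn: "strongly_connected (with_proj G)"
    and w: "\<And>i. w $ i > 0"
  obtains \<kappa> where "\<kappa> > 0" "\<And>e. w \<bullet> e = 0 \<Longrightarrow> \<kappa> * (norm e)\<^sup>2 \<le> dissipation w A e"
proof -
  let ?S = "sphere 0 1 \<inter> {e. w \<bullet> e = 0}"
  have "\<exists>\<kappa>>0. \<forall>e\<in>?S. \<kappa> \<le> dissipation w A e"
  proof (cases "?S = {}")
    case True
    \<comment> \<open>This is the case of a single node: the hyperplane is {0}, and any positive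
      constant serves.\<close>
    then show ?thesis by (auto intro: exI[of _ 1])
  next
    case False
    have "compact ?S" by (intro compact_Int_closed compact_sphere closed_hyperplane)
    moreover have "continuous_on ?S (dissipation w A)"
      unfolding dissipation_def by (intro continuous_intros)
    ultimately obtain m where m: "m \<in> ?S" "\<forall>e\<in>?S. dissipation w A m \<le> dissipation w A e"
      using False continuous_attains_inf by blast
    have "dissipation w A m \<noteq> 0"
    proof
      assume "dissipation w A m = 0"
      then have "m $ j = m $ i" for i j using dissipation_eq_0D[OF adj conn w] by blast
      then obtain r where r: "\<And>i. m $ i = r" by metis
      have "(\<Sum>k\<in>UNIV. w $ k) > 0" using w by (intro sum_pos) auto
      moreover have "w \<bullet> m = (\<Sum>k\<in>UNIV. w $ k) * r"
        by (simp add: inner_vec_def r sum_distrib_right)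
      ultimately have "r = 0" using m(1) by auto
      then have "m = 0" using r by (simp add: vec_eq_iff)
      then show False using m(1) by simp
    qed
    then show ?thesis
      using m(2) dissipation_nonneg[OF adj w] by (metis order_le_less)
  qed
  then obtain \<kappa> where \<kappa>: "\<kappa> > 0" "\<And>e. e \<in> ?S \<Longrightarrow> \<kappa> \<le> dissipation w A e" by blast
  show ?thesis
  proof (rule that[OF \<kappa>(1)])
    fix e assume e: "w \<bullet> e = 0"
    show "\<kappa> * (norm e)\<^sup>2 \<le> dissipation w A e"
    proof (cases "e = 0")
      case True
      then show ?thesis by (simp add: dissipation_def)
    next
      case False
      then have "\<kappa> \<le> dissipation w A (inverse (norm e) *\<^sub>R e)"
        using e by (intro \<kappa>(2)) auto
      then show ?thesis
        using False by (simp add: dissipation_scaleR field_simps)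
    qed
  qed
qed

text \<open>Left null vectors are zero or of one strict sign; an eigenvector is nonzero, and the sum
  1 excludes the negative sign.\<close>

lemma normalized_left_null_laplacian:
  fixes G :: "'n::finite pair_pre_digraph"
  assumes adj: "adjacency_matrix G A" and conn: "strongly_connected (with_proj G)"
  defines "w \<equiv> normalized_left_null (laplacian A)"
  shows "w v* laplacian A = 0" "(\<Sum>k\<in>UNIV. w $ k) = 1" "w $ i > 0"
proof -
  have *: "left_eigenvector (laplacian A) 0 w \<and> (\<Sum>k\<in>UNIV. w $ k) = 1"
    unfolding w_def normalized_left_null_def by (rule theI'[OF laplacian_left_null_ex1[OF adj conn]])
  then show null: "w v* laplacian A = 0" and sum: "(\<Sum>k\<in>UNIV. w $ k) = 1"
    by (auto simp: left_eigenvector_def)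
  have "\<not> (\<forall>i. w $ i < 0)"
    using sum by (metis less_eq_real_def not_one_le_zero sum_nonpos)
  then show "w $ i > 0"
    using left_null_sign[OF adj conn null] * by (auto simp: left_eigenvector_def)
qed

theorem lemma2:
  fixes G :: "'n::finite pair_pre_digraph"
    and A :: "real^'n^'n"
    and \<rho> :: real
    and xbar :: "'n \<Rightarrow> real"
    and x z :: "'n \<Rightarrow> real \<Rightarrow> real"
  assumes "adjacency_matrix G A"
    and "\<rho> > 0"
    and "\<And>i t. t \<ge> 0 \<Longrightarrow>
      z i t = x i t - xbar i
        + \<rho> * integral {0..t} (\<lambda>s. \<Sum>j\<in>in_neighbors G i. A $ i $ j * (x i s - x j s))"
    and "strongly_connected (with_proj G)"
    and "\<And>i. continuous_on {0..} (x i)"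
    and "\<And>i. bounded (z i ` {0..})"
    and "\<And>i. (z i \<longlongrightarrow> 0) at_top"
  shows "(\<forall>i j. ((\<lambda>t. x i t - x j t) \<longlongrightarrow> 0) at_top) \<and>
    (\<forall>i. (x i \<longlongrightarrow> (\<Sum>k\<in>UNIV. normalized_left_null (laplacian A) $ k * xbar k)) at_top)"
proof -
  define w where "w = normalized_left_null (laplacian A)"
  note w = normalized_left_null_laplacian[OF assms(1,4), folded w_def]
  define c where "c = (\<Sum>k\<in>UNIV. w $ k * xbar k)"
  define L where "L = laplacian A"
  define X where "X t = (\<chi> i. x i t)" for t
  define Z where "Z t = (\<chi> i. z i t)" for t
  define y where "y i t = integral {0..t} (\<lambda>s. (L *v X s) $ i)" for i t
  \<comment> \<open>For \<open>t \<ge> 0\<close> this is \<open>x - z - c\<close>. The integral form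
    makes it differentiable although \<open>x\<close> is only continuous. For \<open>t < 0\<close>
    the integral is over an empty interval and is 0, so \<open>e\<close> is defined sensibly for all
    \<open>t\<close>.\<close>
  define e where "e t = (\<chi> i. xbar i - \<rho> * y i t - c)" for t
  have null: "w \<bullet> (L *v u) = 0" for u
    unfolding L_def by (rule inner_laplacian_left_null[OF w(1)])
  have nbr: "(\<Sum>j\<in>in_neighbors G i. A $ i $ j * (x i s - x j s)) = (L *v X s) $ i" for i s
    using sum_in_neighbors_laplacian[OF assms(1), of i "X s"] by (simp add: L_def X_def)
  have x_eq: "x i t = z i t + e t $ i + c" if "t \<ge> 0" for i t
    using assms(3)[OF that, of i] by (simp add: nbr e_def y_def)
  have L_const: "L *v (u + (\<chi> i. r)) = L *v u" for u r
    by (simp add: L_def vec_eq_iff laplacian_mult_component)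
  have LX: "L *v X t = L *v Z t + L *v e t" if "t \<ge> 0" for t
  proof -
    have "X t = (Z t + e t) + (\<chi> i. c)"
      by (simp add: vec_eq_iff X_def Z_def x_eq[OF that])
    then show ?thesis by (metis L_const matrix_vector_right_distrib)
  qed
  have cont: "continuous_on {0..t} (\<lambda>s. (L *v X s) $ i)" for i t
    unfolding L_def laplacian_mult_component X_def vec_lambda_beta
    by (intro continuous_intros continuous_on_subset[OF assms(5)]) auto
  \<comment> \<open>The integrated drift is orthogonal to \<open>w\<close>, so only the initial
    value remains; subtracting \<open>c\<close> cancels it because the weights sum to 1.\<close>
  have we: "w \<bullet> e t = 0" for t
  proof -
    have "(\<Sum>i\<in>UNIV. w $ i * y i t) = integral {0..t} (\<lambda>s. \<Sum>i\<in>UNIV. w $ i * (L *v X s) $ i)"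
      unfolding y_def using integrable_continuous_interval[OF cont]
      by (subst integral_sum) (auto intro!: integrable_on_mult_right)
    also have "\<dots> = 0" using null by (simp add: inner_vec_def)
    finally have "(\<Sum>i\<in>UNIV. w $ i * y i t) = 0" .
    then have "\<rho> * (\<Sum>i\<in>UNIV. w $ i * y i t) = 0" by simp
    moreover have "w \<bullet> e t = c - \<rho> * (\<Sum>i\<in>UNIV. w $ i * y i t) - (\<Sum>i\<in>UNIV. w $ i) * c"
      by (simp add: inner_vec_def e_def right_diff_distrib sum_subtractf c_def[symmetric] sum_distrib_left
          sum_distrib_right mult.left_commute)
    ultimately show ?thesis using w(2) by simp
  qed
  have e_deriv: "((\<lambda>t. e t $ i) has_real_derivative - \<rho> * (L *v X t) $ i) (at t)"
    if "t > 0" for i t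
  proof -
    \<comment> \<open>Reaching up to \<open>t + 1\<close> puts \<open>t\<close> in the interior, so
      the derivative within the interval is the full derivative.\<close>
    have "(y i has_real_derivative (L *v X t) $ i) (at t within {0..t + 1})"
      unfolding y_def using that by (intro integral_has_real_derivative cont) auto
    then have "(y i has_real_derivative (L *v X t) $ i) (at t)"
      using that by (simp add: at_within_Icc_at)
    then show ?thesis by (auto simp: e_def intro!: derivative_eq_intros)
  qed
  obtain \<kappa> where \<kappa>: "\<kappa> > 0" "\<And>e. w \<bullet> e = 0 \<Longrightarrow> \<kappa> * (norm e)\<^sup>2 \<le> dissipation w A e"
    using dissipation_gap[OF assms(1,4) w(3)] by blast
  \<comment> \<open>Dissipation yields the rate \<open>\<rho> * \<kappa>\<close>, which is
    \<open>2 * k\<close>: one half absorbs the cross term with \<open>Z\<close>, the other remains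
    as decay of \<open>V\<close>.\<close>
  define k where "k = \<rho> * \<kappa> / 2"
  have k: "k > 0" using assms(2) \<kappa>(1) by (simp add: k_def)
  define V where "V t = (\<Sum>i\<in>UNIV. w $ i * (e t $ i)\<^sup>2)" for t
  define V' where "V' t = (\<Sum>i\<in>UNIV. w $ i * (2 * e t $ i * (- \<rho> * (L *v X t) $ i)))" for t
  define g where "g t = (\<Sum>i\<in>UNIV. w $ i * (\<rho>\<^sup>2 * ((L *v Z t) $ i)\<^sup>2 / k))" for t
  have w_nonneg: "0 \<le> w $ i" and w_le: "w $ i \<le> 1" for i
    using w(3) member_le_sum[of i UNIV "\<lambda>i. w $ i"] w(2) by (auto simp: less_imp_le)
  \<comment> \<open>Needed to pass from the Euclidean norm in the gap to the weighted
    \<open>V\<close>.\<close>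
  have V_le: "V t \<le> (norm (e t))\<^sup>2" for t
  proof -
    have "V t \<le> (\<Sum>i\<in>UNIV. 1 * (e t $ i)\<^sup>2)"
      unfolding V_def by (intro sum_mono mult_right_mono w_le) auto
    also have "\<dots> = (norm (e t))\<^sup>2"
      unfolding power2_norm_eq_inner by (simp add: inner_vec_def power2_eq_square)
    finally show ?thesis .
  qed
  have V_tendsto: "(V \<longlongrightarrow> 0) at_top"
  proof (rule tendsto_0_of_deriv_le[OF k])
    show "V t \<ge> 0" for t
      unfolding V_def by (intro sum_nonneg mult_nonneg_nonneg w_nonneg) auto
    show "(V has_real_derivative V' t) (at t)" if "t > 0" for t
      unfolding V_def V'_def
      by (rule derivative_eq_intros e_deriv that refl)+ (auto intro!: sum.cong)
    show "(g \<longlongrightarrow> 0) at_top"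
      unfolding g_def L_def laplacian_mult_component Z_def vec_lambda_beta
      by (rule tendsto_eq_intros assms(7) refl | use k in simp)+
    show "V' t \<le> - k * V t + g t" if "t > 0" for t
    proof -
      \<comment> \<open>Applied with \<open>a\<close> the entry of \<open>e\<close> and
        \<open>b\<close> that of \<open>- \<rho> * L Z\<close>; the terms
        \<open>b\<^sup>2 / k\<close> add up to \<open>g\<close>.\<close>
      have young: "2 * a * b \<le> k * a\<^sup>2 + b\<^sup>2 / k" for a b :: real
      proof -
        have "0 \<le> (k * a - b)\<^sup>2 / k" using k by simp
        also have "\<dots> = k * a\<^sup>2 + b\<^sup>2 / k - 2 * a * b"
          using k by (simp add: field_simps power2_eq_square)
        finally show ?thesis by simp
      qed
      \<comment> \<open>Splitting \<open>L X\<close> into \<open>L e\<close> and \<open>L Z\<close>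
        separates the dissipation from the vanishing input.\<close>
      have "V' t = - \<rho> * dissipation w A (e t)
          + (\<Sum>i\<in>UNIV. w $ i * (2 * e t $ i * (- \<rho> * (L *v Z t) $ i)))"
        unfolding V'_def dissipation_eq[OF w(1)] L_def[symmetric] sum_distrib_left
          sum.distrib[symmetric] LX[OF less_imp_le[OF that]]
        by (intro sum.cong refl) (simp add: algebra_simps)
      also have "\<dots> \<le> - \<rho> * (\<kappa> * V t)
          + (\<Sum>i\<in>UNIV. w $ i * (k * (e t $ i)\<^sup>2 + (- \<rho> * (L *v Z t) $ i)\<^sup>2 / k))"
      proof (rule add_mono)
        have "\<kappa> * V t \<le> dissipation w A (e t)"
          using \<kappa>(2)[OF we] mult_left_mono[OF V_le, of \<kappa> t] \<kappa>(1) by (smt (verit))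
        then show "- \<rho> * dissipation w A (e t) \<le> - \<rho> * (\<kappa> * V t)"
          using assms(2) by simp
      qed (intro sum_mono mult_left_mono w_nonneg young)
      also have "\<dots> = - k * V t + g t"
      proof -
        have "(\<Sum>i\<in>UNIV. w $ i * (k * (e t $ i)\<^sup>2 + (- \<rho> * (L *v Z t) $ i)\<^sup>2 / k))
            = k * V t + g t"
          by (simp add: V_def g_def distrib_left sum.distrib sum_distrib_left power_mult_distrib
              mult.left_commute)
        moreover have "- \<rho> * (\<kappa> * V t) = - 2 * k * V t" by (simp add: k_def)
        ultimately show ?thesis by linarith
      qed
      finally show ?thesis .
    qed
  qed
  have e_tendsto: "((\<lambda>t. e t $ i) \<longlongrightarrow> 0) at_top" for i
  proof -
    \<comment> \<open>A single summand of \<open>V\<close>; since \<open>w $ i > 0\<close>, it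
      controls its coordinate.\<close>
    have "w $ i * (e t $ i)\<^sup>2 \<le> V t" for t
      unfolding V_def by (rule member_le_sum) (auto simp: w_nonneg)
    then have "(e t $ i)\<^sup>2 \<le> V t / w $ i" for t
      using w(3)[of i] by (simp add: field_simps)
    then have "((\<lambda>t. (e t $ i)\<^sup>2) \<longlongrightarrow> 0) at_top"
      using tendsto_divide_zero[OF V_tendsto, of "w $ i"]
        tendsto_sandwich[of "\<lambda>_. 0" "\<lambda>t. (e t $ i)\<^sup>2" at_top "\<lambda>t. V t / w $ i" 0]
      by (simp add: always_eventually)
    from tendsto_real_sqrt[OF this] show ?thesis by (simp add: tendsto_rabs_zero_iff)
  qed
  have lim: "(x i \<longlongrightarrow> c) at_top" for i
  proof (rule Lim_transform_eventually)
    show "((\<lambda>t. z i t + e t $ i + c) \<longlongrightarrow> c) at_top"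
      by (rule tendsto_eq_intros assms(7) e_tendsto refl | simp)+
    show "eventually (\<lambda>t. z i t + e t $ i + c = x i t) at_top"
      using eventually_ge_at_top[of 0] by eventually_elim (simp add: x_eq)
  qed
  have "((\<lambda>t. x i t - x j t) \<longlongrightarrow> 0) at_top" for i j
    using tendsto_diff[OF lim lim] by simp
  then show ?thesis using lim by (simp add: c_def w_def)
qed

end
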